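(* Let $\alpha<0$ be real. As $n\to\infty$, the smallest eigenvalue $\lambda_{\alpha,n,1}$ of $L_{\alpha,n}$ converges exponentially to $\Omega_\alpha$. More precisely, there exists $C_2(\alpha)>0$ such that for every integer $n\ge N_\alpha$, $$\left|\lambda_{\alpha,n,1}-\left(\Omega_\alpha+\beta_{\alpha,1}e^{-n\omega_\alpha}+\beta_{\alpha,2}\,n\,e^{-2n\omega_\alpha}-\beta_{\alpha,3}e^{-2n\omega_\alpha}\right)\right|\le C_2(\alpha)\,n^2e^{-3n\omega_\alpha}.$$
   Context: For an integer $n\ge3$ and real $\alpha<0$, $L_{\alpha,n}$ is the real symmetric $n\times n$ matrix whose entries are: $(1,1)$ and $(n,n)$ entries equal to $1+\alpha$; $(1,n)$ and $(n,1)$ entries equal to $-\alpha$; $(k,k)$ entries equal to $2$ for $2\le k\le n-1$; $(k,k+1)$ and $(k+1,k)$ entries equal to $-1$ for $1\le k\le n-1$; all other entries $0$. Its eigenvalues, counted with multiplicity, are $\lambda_{\alpha,n,1}\le\dots\le\lambda_{\alpha,n,n}$. Put $\varkappa_\alpha=\frac{\alpha-1}{\alpha}$, $N_\alpha=\max\{3,\lfloor\varkappa_\alpha\rfloor+1\}$, $\omega_\alpha=\log(1-2\alpha)$, $\Omega_\alpha=\frac{4\alpha^2}{2\alpha-1}$, and $$\beta_{\alpha,1}=\frac{16\alpha^2(\alpha-1)^2}{(1-2\alpha)^2},\quad \beta_{\alpha,2}=\frac{64\alpha^3(\alpha-1)^3}{(1-2\alpha)^3},\quad \beta_{\alpha,3}=\frac{32\alpha^2(1-\alpha)^2(2\alpha^2-2\alpha+1)}{(1-2\alpha)^3}.$$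 *)

theory Defs
  imports Complex_Main "Jordan_Normal_Form.Char_Poly"
begin

(* Rows and columns of a mat are numbered from 0, so the entry (j,k) of the
   mathematical matrix is the entry (j-1,k-1) here.  The matrix is meant for n >= 3. *)
definition L_mat :: "real \<Rightarrow> nat \<Rightarrow> real mat" where
  "L_mat \<alpha> n = mat n n (\<lambda>(j, k).
     if j = k then (if j = 0 \<or> j = n - 1 then 1 + \<alpha> else 2)
     else if (j = 0 \<and> k = n - 1) \<or> (j = n - 1 \<and> k = 0) then - \<alpha>
     else if k = j + 1 \<or> j = k + 1 then - 1
     else 0)"

(* The k-th smallest eigenvalue of a real matrix, k = 1, 2, ..., where a real root of the
   characteristic polynomial of multiplicity m is listed m times.  A real symmetric
   n x n matrix has exactly n such eigenvalues; for k outside the range of the list the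
   value is unspecified. *)
definition sorted_eigenvalue :: "real mat \<Rightarrow> nat \<Rightarrow> real" where
  "sorted_eigenvalue A k = sorted_list_of_multiset (proots (char_poly A)) ! (k - 1)"

definition lambda_L :: "real \<Rightarrow> nat \<Rightarrow> nat \<Rightarrow> real" where
  "lambda_L \<alpha> n k = sorted_eigenvalue (L_mat \<alpha> n) k"

definition kappa :: "real \<Rightarrow> real" where
  "kappa \<alpha> = (\<alpha> - 1) / \<alpha>"

definition N_min :: "real \<Rightarrow> int" where
  "N_min \<alpha> = max 3 (\<lfloor>kappa \<alpha>\<rfloor> + 1)"

definition omega :: "real \<Rightarrow> real" where
  "omega \<alpha> = ln (1 - 2 * \<alpha>)"

definition Omega_lim :: "real \<Rightarrow> real" where
  "Omega_lim \<alpha> = 4 * \<alpha>^2 / (2 * \<alpha> - 1)"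

definition beta1 :: "real \<Rightarrow> real" where
  "beta1 \<alpha> = 16 * \<alpha>^2 * (\<alpha> - 1)^2 / (1 - 2 * \<alpha>)^2"

definition beta2 :: "real \<Rightarrow> real" where
  "beta2 \<alpha> = 64 * \<alpha>^3 * (\<alpha> - 1)^3 / (1 - 2 * \<alpha>)^3"

definition beta3 :: "real \<Rightarrow> real" where
  "beta3 \<alpha> = 32 * \<alpha>^2 * (1 - \<alpha>)^2 * (2 * \<alpha>^2 - 2 * \<alpha> + 1) / (1 - 2 * \<alpha>)^3"

end

theory Submission
  imports Defs "HOL-Library.Landau_Symbols"
begin

text \<open>
  The matrix is the Laplacian of a weighted cycle: its quadratic form is
  \<open>\<Sum>k. (x (k+1) - x k)\<^sup>2 + \<alpha> (x 1 - x n)\<^sup>2\<close>.  Only the last term can be negative, and it vanishes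
  on the hyperplane \<open>x 1 = x n\<close>.  A hyperplane contains a nonzero vector of every plane, so there is no room for two
  negative eigenvalues (\<open>negative_eigenvalue_unique\<close>).  Hence any negative eigenvalue that can be
  written down is automatically the smallest one.

  Solutions of the three-term recurrence in the interior rows are combinations of \<open>q ^ k\<close> and
  \<open>q ^ (-k)\<close>, with eigenvalue \<open>2 - q - 1 / q\<close>.  With \<open>p = 1 - 2 \<alpha> > 1\<close>, the combination that is odd
  under reversal of the indices satisfies the two end rows exactly when
  \<open>q ^ n (q - p) = 1 - p q\<close> (\<open>sinh_eigenvector\<close>, \<open>lambda_L_1_eq\<close>).

  Put \<open>q = p - \<delta>\<close>.  The equation becomes \<open>\<delta> (p - \<delta>) ^ n = p (p - \<delta>) - 1\<close>, and since its right-hand side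
  is about \<open>A = p\<^sup>2 - 1\<close>, it has a root of size \<open>A \<epsilon>\<close>, where \<open>\<epsilon> = p ^ (-n) = exp (- n \<omega>)\<close>
  (\<open>eventually_secular_root\<close>).  Multiplied by \<open>\<epsilon>\<close> it reads
  \<open>\<delta> (1 - \<delta> / p) ^ n = \<epsilon> (A - p \<delta>)\<close>; expanding the power to first order and iterating twice gives
  \<open>\<delta> = A \<epsilon> - p A \<epsilon>\<^sup>2 + A\<^sup>2 n \<epsilon>\<^sup>2 / p + O(n\<^sup>2 \<epsilon>\<^sup>3)\<close> (\<open>secular_root_expansion\<close>).  Insertion into
  \<open>2 - q - 1 / q\<close>, whose value at \<open>q = p\<close> is the limit \<open>\<Omega>\<close>, yields the coefficients
  \<open>\<beta>1 = A\<^sup>2 / p\<^sup>2\<close>, \<open>\<beta>2 = A\<^sup>3 / p\<^sup>3\<close> and \<open>\<beta>3 = A\<^sup>2 (p\<^sup>2 + 1) / p\<^sup>3\<close>.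

  The expansion holds for large \<open>n\<close>; as the right-hand sides of the claimed bounds are positive, the
  finitely many remaining \<open>n\<close> are absorbed into the constants (\<open>bigo_imp_bound_from\<close>).
\<close>

section \<open>The quadratic form and the negative eigenvalue\<close>

lemma L_mat_dim [simp]: "dim_row (L_mat \<alpha> n) = n" "dim_col (L_mat \<alpha> n) = n"
  by (simp_all add: L_mat_def)

text \<open>
  Splitting each row into a contribution of the edge to the right, the edge to the left and the
  closing edge of weight \<open>\<alpha>\<close> makes the summation by parts below independent of the boundary rows.
\<close>

lemma L_mat_mult_vec_index:
  fixes v :: "real vec"
  assumes m: "m \<ge> 2" and v: "v \<in> carrier_vec (Suc m)" and i: "i \<le> m"
  shows "(L_mat \<alpha> (Suc m) *\<^sub>v v) $ i =
    (if i < m then v $ i - v $ Suc i else 0) + (if 0 < i then v $ i - v $ (i - 1) else 0)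
    + (if i = 0 then \<alpha> * (v $ 0 - v $ m) else if i = m then \<alpha> * (v $ m - v $ 0) else 0)"
proof -
  have row: "(L_mat \<alpha> (Suc m) *\<^sub>v v) $ i = (\<Sum>j = 0..<Suc m. L_mat \<alpha> (Suc m) $$ (i, j) * v $ j)"
    using v i by (simp add: scalar_prod_def del: sum.op_ivl_Suc)
  have entries: "(\<Sum>j = 0..<Suc m. L_mat \<alpha> (Suc m) $$ (i, j) * v $ j) = (\<Sum>j = 0..<Suc m. f j)"
    if "\<And>j. j \<le> m \<Longrightarrow> L_mat \<alpha> (Suc m) $$ (i, j) * v $ j = f j" for f
    using that by (intro sum.cong) auto
  consider "i = 0" | "i = m" | "0 < i" "i < m" using i by linarith
  then show ?thesis
  proof cases
    case 1
    then show ?thesis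
      unfolding row using m
      by (subst entries[of "\<lambda>j. (if j = 0 then (1 + \<alpha>) * v $ 0 else 0)
          + (if j = 1 then - v $ 1 else 0) + (if j = m then - \<alpha> * v $ m else 0)"])
        (auto simp: L_mat_def sum.distrib algebra_simps simp del: sum.op_ivl_Suc)
  next
    case 2
    then show ?thesis
      unfolding row using m
      by (subst entries[of "\<lambda>j. (if j = m then (1 + \<alpha>) * v $ m else 0)
          + (if j = m - 1 then - v $ (m - 1) else 0) + (if j = 0 then - \<alpha> * v $ 0 else 0)"])
        (auto simp: L_mat_def sum.distrib algebra_simps simp del: sum.op_ivl_Suc)
  next
    case 3
    then show ?thesis
      unfolding row using m
      by (subst entries[of "\<lambda>j. (if j = i then 2 * v $ i else 0)
          + (if j = Suc i then - v $ Suc i else 0) + (if j = i - 1 then - v $ (i - 1) else 0)"])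
        (auto simp: L_mat_def sum.distrib algebra_simps simp del: sum.op_ivl_Suc)
  qed
qed

lemma sum_path_laplacian:
  fixes x y :: "nat \<Rightarrow> real"
  shows "(\<Sum>i\<le>m. y i * ((if i < m then x i - x (Suc i) else 0) + (if 0 < i then x i - x (i - 1) else 0)))
    = (\<Sum>k<m. (x (Suc k) - x k) * (y (Suc k) - y k))"
proof -
  have 1: "(\<Sum>i\<le>m. y i * (if i < m then x i - x (Suc i) else 0)) = (\<Sum>k<m. y k * (x k - x (Suc k)))"
    by (simp add: lessThan_Suc_atMost[symmetric])
  have 2: "(\<Sum>i\<le>m. y i * (if 0 < i then x i - x (i - 1) else 0)) = (\<Sum>k<m. y (Suc k) * (x (Suc k) - x k))"
    by (subst lessThan_Suc_atMost[symmetric], subst sum.lessThan_Suc_shift) simp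
  show ?thesis
    by (simp add: distrib_left sum.distrib 1 2 algebra_simps sum_subtractf)
qed

text \<open>
  The eigenvalue equation tested against an arbitrary \<open>y\<close>.  The right-hand side is a symmetric
  bilinear form in \<open>v\<close> and \<open>y\<close>, which carries both the symmetry of the matrix and the sign
  information about its quadratic form.
\<close>

lemma eigenvector_weak_form:
  fixes v :: "real vec" and y :: "nat \<Rightarrow> real"
  assumes m: "m \<ge> 2" and ev: "eigenvector (L_mat \<alpha> (Suc m)) v \<mu>"
  shows "\<mu> * (\<Sum>i\<le>m. v $ i * y i)
    = (\<Sum>k<m. (v $ Suc k - v $ k) * (y (Suc k) - y k)) + \<alpha> * (v $ 0 - v $ m) * (y 0 - y m)"
proof -
  have v: "v \<in> carrier_vec (Suc m)" and eq: "L_mat \<alpha> (Suc m) *\<^sub>v v = \<mu> \<cdot>\<^sub>v v"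
    using ev by (auto simp: eigenvector_def)
  let ?c = "\<lambda>i. if i = 0 then \<alpha> * (v $ 0 - v $ m) else if i = m then \<alpha> * (v $ m - v $ 0) else 0"
  have "\<mu> * (\<Sum>i\<le>m. v $ i * y i) = (\<Sum>i\<le>m. y i * (L_mat \<alpha> (Suc m) *\<^sub>v v) $ i)"
    unfolding eq sum_distrib_left using v by (intro sum.cong) auto
  also have "\<dots> = (\<Sum>i\<le>m. y i * ((if i < m then v $ i - v $ Suc i else 0)
      + (if 0 < i then v $ i - v $ (i - 1) else 0)) + y i * ?c i)"
    by (intro sum.cong) (simp_all add: L_mat_mult_vec_index[OF m v] distrib_left del: index_mult_mat_vec)
  also have "\<dots> = (\<Sum>k<m. (v $ Suc k - v $ k) * (y (Suc k) - y k)) + (\<Sum>i\<le>m. y i * ?c i)"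
    by (simp only: sum.distrib sum_path_laplacian)
  also have "(\<Sum>i\<le>m. y i * ?c i) = (\<Sum>i\<le>m. (if i = 0 then \<alpha> * (v $ 0 - v $ m) * y 0 else 0)
      + (if i = m then \<alpha> * (v $ m - v $ 0) * y m else 0))"
    using m by (intro sum.cong) auto
  also have "\<dots> = \<alpha> * (v $ 0 - v $ m) * (y 0 - y m)"
    by (simp add: sum.distrib algebra_simps)
  finally show ?thesis .
qed

text \<open>
  Eigenvectors \<open>v\<close>, \<open>w\<close> for two different negative eigenvalues are orthogonal, so the form is negative
  on every nonzero combination of them.  Some such combination \<open>z\<close> has equal end entries, and
  there the form is a sum of squares.
\<close>

lemma negative_eigenvalue_unique:
  assumes m: "m \<ge> 2" and "eigenvalue (L_mat \<alpha> (Suc m)) \<mu>" "eigenvalue (L_mat \<alpha> (Suc m)) \<nu>"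
    and neg: "\<mu> < 0" "\<nu> < 0"
  shows "\<mu> = \<nu>"
proof (rule ccontr)
  assume ne: "\<mu> \<noteq> \<nu>"
  obtain v w where v: "eigenvector (L_mat \<alpha> (Suc m)) v \<mu>" and w: "eigenvector (L_mat \<alpha> (Suc m)) w \<nu>"
    using assms by (auto simp: eigenvalue_def)
  define E where "E x y = (\<Sum>k<m. (x (Suc k) - x k) * (y (Suc k) - y k)) + \<alpha> * (x 0 - x m) * (y 0 - y m)"
    for x y :: "nat \<Rightarrow> real"
  define D where "D x y = (\<Sum>i\<le>m. x i * y i)" for x y :: "nat \<Rightarrow> real"
  have Ev: "E (($) v) y = \<mu> * D (($) v) y" and Ew: "E (($) w) y = \<nu> * D (($) w) y" for y
    using eigenvector_weak_form[OF m v] eigenvector_weak_form[OF m w] by (auto simp: E_def D_def)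
  have Esym: "E x y = E y x" and Dsym: "D x y = D y x" for x y
    by (simp_all add: E_def D_def mult.commute mult.left_commute)
  have nonneg: "E x x \<ge> 0" if "x 0 = x m" for x
    using that by (auto simp: E_def intro!: sum_nonneg)
  have pos: "D (($) u) (($) u) > 0" if "eigenvector (L_mat \<alpha> (Suc m)) u \<rho>" for u \<rho>
  proof -
    have u: "u \<in> carrier_vec (Suc m)" "u \<noteq> 0\<^sub>v (Suc m)"
      using that by (auto simp: eigenvector_def)
    then obtain i where "i \<le> m" "u $ i \<noteq> 0"
      by (metis carrier_vecD eq_vecI index_zero_vec(1) index_zero_vec(2) less_Suc_eq_le)
    then show ?thesis
      unfolding D_def by (intro sum_pos2[of _ i]) (auto simp: zero_less_mult_iff linorder_neq_iff)
  qed
  have orth: "D (($) v) (($) w) = 0"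
    using Ev[of "($) w"] Ew[of "($) v"] Esym Dsym ne by (metis mult_right_cancel)
  \<comment> \<open>The coefficients are chosen so that the end entries of \<open>z\<close> agree.\<close>
  define a b where "a = w $ 0 - w $ m" and "b = v $ m - v $ 0"
  define z where "z i = a * v $ i + b * w $ i" for i
  have "E z z = a\<^sup>2 * E (($) v) (($) v) + 2 * a * b * E (($) v) (($) w) + b\<^sup>2 * E (($) w) (($) w)"
    by (simp add: E_def z_def sum_distrib_left sum.distrib[symmetric] algebra_simps power2_eq_square)
  then have "E z z = a\<^sup>2 * (\<mu> * D (($) v) (($) v)) + b\<^sup>2 * (\<nu> * D (($) w) (($) w))"
    by (simp add: Ev Ew orth)
  moreover have "z 0 = z m"
    by (simp add: z_def a_def b_def algebra_simps)
  moreover have "\<mu> * D (($) v) (($) v) < 0" "\<nu> * D (($) w) (($) w) < 0"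
    using neg pos[OF v] pos[OF w] by (simp_all add: mult_neg_pos)
  \<comment> \<open>If \<open>a = 0\<close>, then \<open>w\<close> itself has equal end entries, and the form is nonnegative there.\<close>
  moreover have "a \<noteq> 0"
    using nonneg[of "($) w"] calculation(4) Ew[of "($) w"] by (auto simp: a_def)
  ultimately show False
    using nonneg[of z] mult_pos_neg[of "a\<^sup>2" "\<mu> * D (($) v) (($) v)"]
      mult_nonneg_nonpos[of "b\<^sup>2" "\<nu> * D (($) w) (($) w)"] by force
qed

text \<open>
  Up to a scalar, the eigenvector is \<open>sinh (t (k - m / 2))\<close> for \<open>k = 0, ..., m\<close> with \<open>q = exp t\<close>.  Since it is odd
  under \<open>k \<mapsto> m - k\<close>, the two end rows give one and the same condition on \<open>q\<close>.
\<close>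

lemma sinh_eigenvector:
  fixes q :: real
  assumes m: "m \<ge> 2" and q: "q > 1"
    and secular: "q ^ Suc m * (q - (1 - 2 * \<alpha>)) = 1 - (1 - 2 * \<alpha>) * q"
  shows "eigenvalue (L_mat \<alpha> (Suc m)) (2 - q - 1 / q)"
proof -
  define y where "y i = q ^ i - q ^ (m - i)" for i
  define v where "v = vec (Suc m) y"
  have vi: "v $ i = y i" if "i \<le> m" for i
    using that by (simp add: v_def)
  have "1 < q ^ m" using q m by (intro one_less_power) auto
  then have "v \<noteq> 0\<^sub>v (Suc m)"
    using vi[of 0] by (auto simp: y_def)
  moreover have "(L_mat \<alpha> (Suc m) *\<^sub>v v) $ i = (2 - q - 1 / q) * y i" if i: "i \<le> m" for i
  proof -
    obtain k where k: "m = Suc k" using m by (cases m) auto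
    have end_eq: "(1 - q ^ m) - (q - q ^ k) + \<alpha> * ((1 - q ^ m) - (q ^ m - 1)) = (2 - q - 1 / q) * (1 - q ^ m)"
    proof -
      have "q * ((1 - q ^ m) - (q - q ^ k) + \<alpha> * ((1 - q ^ m) - (q ^ m - 1)))
          = q * ((2 - q - 1 / q) * (1 - q ^ m))"
      proof -
        have "q * ((2 - q - 1 / q) * (1 - q ^ m)) = (2 * q - q * q - 1) * (1 - q ^ m)"
          using q by (simp add: field_simps)
        then show ?thesis
          using secular unfolding k by (simp add: algebra_simps)
      qed
      then show ?thesis using q by simp
    qed
    consider "i = 0" | "i = m" | "0 < i" "i < m" using i by linarith
    then show ?thesis
    proof cases
      case 1
      then show ?thesis
        using m end_eq by (simp add: L_mat_mult_vec_index v_def k y_def del: index_mult_mat_vec)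
    next
      case 2
      then show ?thesis
        using m end_eq by (simp add: L_mat_mult_vec_index v_def k y_def algebra_simps del: index_mult_mat_vec)
    next
      case 3
      then obtain a b where ab: "i = Suc a" "m = Suc a + Suc b"
        by (metis Suc_pred add.commute less_imp_add_positive gr0_implies_Suc)
      then have "m - i = Suc b" "m - Suc i = b" "m - a = Suc (Suc b)" by auto
      then have "y i - y (Suc i) + (y i - y (i - 1)) = (2 - q - 1 / q) * y i"
        unfolding y_def using ab(1) q by (simp add: field_simps)
      then show ?thesis
        using 3 m by (simp add: L_mat_mult_vec_index v_def del: index_mult_mat_vec)
    qed
  qed
  then have "L_mat \<alpha> (Suc m) *\<^sub>v v = (2 - q - 1 / q) \<cdot>\<^sub>v v"
    by (intro eq_vecI) (auto simp: v_def)
  ultimately show ?thesis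
    unfolding eigenvalue_def eigenvector_def
    by (intro exI[of _ v]) (auto simp: v_def)
qed

lemma nth_0_sorted_list_of_multiset:
  assumes "x \<in># M" and "\<And>y. y \<in># M \<Longrightarrow> x \<le> y"
  shows "sorted_list_of_multiset M ! 0 = x"
proof (rule antisym)
  let ?xs = "sorted_list_of_multiset M"
  have set: "set ?xs = set_mset M" by simp
  then obtain i where i: "i < length ?xs" "?xs ! i = x"
    using assms(1) by (metis in_set_conv_nth)
  then show "?xs ! 0 \<le> x"
    by (metis sorted_nth_mono sorted_sorted_list_of_multiset zero_le)
  show "x \<le> ?xs ! 0"
    using assms(2) set i nth_mem[of 0 ?xs] by (metis length_greater_0_conv list.size(3) not_less_zero)
qed

text \<open>
  For \<open>q > 1\<close> the eigenvalue \<open>2 - q - 1 / q = - (q - 1)\<^sup>2 / q\<close> is negative, hence by uniqueness the least.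
\<close>

lemma lambda_L_1_eq:
  fixes q :: real
  assumes n: "n \<ge> 3" and q: "q > 1"
    and secular: "q ^ n * (q - (1 - 2 * \<alpha>)) = 1 - (1 - 2 * \<alpha>) * q"
  shows "lambda_L \<alpha> n 1 = 2 - q - 1 / q"
proof -
  obtain m where m: "n = Suc m" "m \<ge> 2" using n by (cases n) auto
  have carrier: "L_mat \<alpha> n \<in> carrier_mat n n" by (simp add: L_mat_def)
  have "char_poly (L_mat \<alpha> n) \<noteq> 0"
    using degree_monic_char_poly[OF carrier] by auto
  then have roots: "x \<in># proots (char_poly (L_mat \<alpha> n)) \<longleftrightarrow> eigenvalue (L_mat \<alpha> n) x" for x
    by (simp add: eigenvalue_root_char_poly[OF carrier])
  have ev: "eigenvalue (L_mat \<alpha> n) (2 - q - 1 / q)"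
    using sinh_eigenvector[OF m(2) q] secular by (simp add: m(1))
  have "2 - q - 1 / q = - ((q - 1)\<^sup>2 / q)"
    using q by (simp add: field_simps power2_eq_square)
  then have neg: "2 - q - 1 / q < 0" using q by simp
  have "2 - q - 1 / q \<le> x" if "eigenvalue (L_mat \<alpha> n) x" for x
    using negative_eigenvalue_unique[OF m(2), of \<alpha> x "2 - q - 1 / q"] that ev neg
    by (cases "x < 0") (auto simp: m(1))
  then have "sorted_list_of_multiset (proots (char_poly (L_mat \<alpha> n))) ! 0 = 2 - q - 1 / q"
    using ev by (intro nth_0_sorted_list_of_multiset) (simp_all only: roots)
  then show ?thesis
    by (simp add: lambda_L_def sorted_eigenvalue_def)
qed

section \<open>The secular equation\<close>

text \<open>
  At \<open>\<delta> = 0\<close> the left-hand side of \<open>\<delta> (p - \<delta>) ^ n = p (p - \<delta>) - 1\<close> is the smaller one.  Doubling the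
  expected size of the root, to \<open>d n = 2 A p ^ (-n)\<close>, reverses the inequality: because \<open>n d n\<close> tends to 0,
  Bernoulli's inequality gives \<open>(p - d n) ^ n \<ge> p ^ n / 2\<close> for large \<open>n\<close>, so the left-hand side is at least
  \<open>A\<close> there.  The intermediate value theorem does the rest.
\<close>

lemma eventually_secular_root:
  fixes p :: real
  assumes p: "p > 1"
  shows "\<forall>\<^sub>F n in sequentially. \<exists>\<delta>. 0 \<le> \<delta> \<and> \<delta> \<le> 2 * (p\<^sup>2 - 1) * (1 / p) ^ n \<and> p - \<delta> > 1
    \<and> \<delta> * (p - \<delta>) ^ n = p * (p - \<delta>) - 1"
proof -
  define A where "A = p\<^sup>2 - 1"
  have A: "A > 0" using p by (simp add: A_def one_less_power)
  define d where "d n = 2 * A * (1 / p) ^ n" for n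
  have "(\<lambda>n. 2 * A * (1 / p) ^ n) \<longlonglongrightarrow> 2 * A * 0"
    using p by (intro tendsto_intros LIMSEQ_power_zero) auto
  then have "d \<longlonglongrightarrow> 0" by (simp add: d_def[abs_def])
  then have e1: "\<forall>\<^sub>F n in sequentially. d n < p - 1"
    using p by (intro order_tendstoD(2)) auto
  have "(\<lambda>n. 2 * A / p * (real n * (1 / p) ^ n)) \<longlonglongrightarrow> 2 * A / p * 0"
    using p by (intro tendsto_intros powser_times_n_limit_0) auto
  then have "(\<lambda>n. real n * (d n / p)) \<longlonglongrightarrow> 0" by (simp add: d_def mult_ac)
  then have e2: "\<forall>\<^sub>F n in sequentially. real n * (d n / p) < 1 / 2"
    by (intro order_tendstoD(2)) auto
  show ?thesis
    using e1 e2
  proof eventually_elim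
    case (elim n)
    let ?F = "\<lambda>t. t * (p - t) ^ n - (p * (p - t) - 1)"
    have d0: "d n > 0" using A p by (simp add: d_def)
    have "p ^ n * (1 / 2) \<le> p ^ n * (1 + real n * (- (d n / p)))"
      using elim p by (intro mult_left_mono) auto
    also have "\<dots> \<le> p ^ n * (1 + - (d n / p)) ^ n"
      using elim p d0 by (intro mult_left_mono Bernoulli_inequality) (auto simp: field_simps)
    also have "\<dots> = (p - d n) ^ n"
      using p by (simp add: power_mult_distrib[symmetric] field_simps)
    finally have "d n * (p ^ n * (1 / 2)) \<le> d n * (p - d n) ^ n"
      using d0 by (intro mult_left_mono) auto
    moreover have "d n * (p ^ n * (1 / 2)) = A"
      using p by (simp add: d_def field_simps)
    moreover have "?F (d n) = d n * (p - d n) ^ n - A + p * d n"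
      by (simp add: A_def algebra_simps power2_eq_square)
    moreover have "p * d n > 0" using d0 p by simp
    ultimately have "?F (d n) \<ge> 0" by linarith
    moreover have "?F 0 \<le> 0" using A by (simp add: A_def power2_eq_square)
    moreover have "continuous_on {0..d n} ?F" by (intro continuous_intros)
    ultimately obtain t where "0 \<le> t" "t \<le> d n" "?F t = 0"
      using IVT'[of ?F 0 0 "d n"] d0 by auto
    then show ?case
      using elim by (intro exI[of _ t]) (auto simp: d_def A_def)
  qed
qed

lemma one_minus_power_second_order:
  fixes u :: real
  assumes "0 \<le> u" "u \<le> 1"
  shows "\<bar>(1 - u) ^ n - (1 - real n * u)\<bar> \<le> (real n * u)\<^sup>2"
proof -
  have "(1 - u) ^ n \<ge> 1 - real n * u"
    using Bernoulli_inequality[of "- u" n] assms by simp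
  moreover have "(1 - u) ^ n \<le> 1 - real n * u + (real n * u)\<^sup>2"
  proof (induction n)
    case (Suc n)
    have "(1 - u) ^ Suc n \<le> (1 - u) * (1 - real n * u + (real n * u)\<^sup>2)"
      using Suc assms by (simp add: mult_left_mono)
    also have "\<dots> = 1 - real (Suc n) * u + (real (Suc n) * u)\<^sup>2
        - (real n * u\<^sup>2 + u\<^sup>2 + (real n * u)\<^sup>2 * u)"
      by (simp add: algebra_simps power2_eq_square)
    moreover have "0 \<le> real n * u\<^sup>2 + u\<^sup>2 + (real n * u)\<^sup>2 * u"
      using assms by (intro add_nonneg_nonneg mult_nonneg_nonneg) auto
    ultimately show ?case by linarith
  qed simp
  ultimately show ?thesis by simp
qed

text \<open>
  The equation is brought into the fixed-point form
  \<open>\<delta> = A \<epsilon> - p \<epsilon> \<delta> + n \<delta>\<^sup>2 / p - \<delta> R\<close>, where \<open>R = O((n \<epsilon>)\<^sup>2)\<close> is the second-order remainder of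
  \<open>(1 - \<delta> / p) ^ n\<close>.  Each estimate for \<open>\<delta>\<close>, inserted on the right, produces the next of the three below.
\<close>

lemma secular_root_expansion:
  fixes p :: real and \<delta> :: "nat \<Rightarrow> real"
  defines "A \<equiv> p\<^sup>2 - 1" and "\<epsilon> \<equiv> \<lambda>n::nat. (1 / p) ^ n"
  assumes p: "p > 1"
    and root: "\<forall>\<^sub>F n in sequentially. 0 \<le> \<delta> n \<and> \<delta> n \<le> 2 * A * \<epsilon> n \<and> p - \<delta> n > 1
      \<and> \<delta> n * (p - \<delta> n) ^ n = p * (p - \<delta> n) - 1"
  shows "\<delta> \<in> O(\<epsilon>)"
    and "(\<lambda>n. \<delta> n - A * \<epsilon> n) \<in> O(\<lambda>n. real n * \<epsilon> n ^ 2)"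
    and "(\<lambda>n. \<delta> n - (A * \<epsilon> n - p * A * \<epsilon> n ^ 2 + A\<^sup>2 / p * real n * \<epsilon> n ^ 2))
      \<in> O(\<lambda>n. real n ^ 2 * \<epsilon> n ^ 3)"
proof -
  define R where "R n = (1 - \<delta> n / p) ^ n - (1 - real n * (\<delta> n / p))" for n
  show d: "\<delta> \<in> O(\<epsilon>)"
  proof (rule bigoI[of _ "2 * A"])
    show "\<forall>\<^sub>F n in sequentially. norm (\<delta> n) \<le> 2 * A * norm (\<epsilon> n)"
      using root by eventually_elim (use p in \<open>auto simp: \<epsilon>_def\<close>)
  qed
  have "\<forall>\<^sub>F n in sequentially. norm (R n) \<le> 1 * norm ((real n * (\<delta> n / p))\<^sup>2)"
    using root
  proof eventually_elim
    case (elim n)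
    then have "0 \<le> \<delta> n / p" "\<delta> n / p \<le> 1" using p by auto
    from one_minus_power_second_order[OF this, of n] show ?case
      by (simp add: R_def)
  qed
  then have "R \<in> O(\<lambda>n. (real n * (\<delta> n / p))\<^sup>2)" by (rule bigoI)
  also have "(\<lambda>n. (real n * (\<delta> n / p))\<^sup>2) \<in> O(\<lambda>n. (real n * \<epsilon> n)\<^sup>2)"
    using p d by (intro landau_o.big_power landau_o.big.mult) auto
  finally have R: "R \<in> O(\<lambda>n. (real n * \<epsilon> n)\<^sup>2)" .
  have \<delta>_eq: "\<forall>\<^sub>F n in sequentially.
      \<delta> n = A * \<epsilon> n - p * (\<epsilon> n * \<delta> n) + 1 / p * (real n * \<delta> n ^ 2) - \<delta> n * R n"
    using root
  proof eventually_elim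
    case (elim n)
    have "(p - \<delta> n) ^ n * \<epsilon> n = (1 - \<delta> n / p) ^ n"
      using p by (simp add: \<epsilon>_def power_mult_distrib[symmetric] field_simps)
    also have "\<dots> = R n + 1 - real n * (\<delta> n / p)" by (simp add: R_def)
    \<comment> \<open>This is the secular equation multiplied by \<open>\<epsilon> n\<close>.\<close>
    finally have "\<delta> n * (R n + 1 - real n * (\<delta> n / p)) = (p * (p - \<delta> n) - 1) * \<epsilon> n"
      using elim by (metis mult.assoc)
    then show ?case
      using p by (simp add: A_def field_simps power2_eq_square)
  qed
  have lift: "(\<lambda>n. real n ^ a * \<epsilon> n ^ c) \<in> O(\<lambda>n. real n ^ b * \<epsilon> n ^ c)" if "a \<le> b" for a b c :: nat
  proof (rule bigoI[of _ 1])
    show "\<forall>\<^sub>F n in sequentially. norm (real n ^ a * \<epsilon> n ^ c) \<le> 1 * norm (real n ^ b * \<epsilon> n ^ c)"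
      using eventually_ge_at_top[of 1]
      by eventually_elim (use p that in \<open>auto simp: \<epsilon>_def abs_mult intro!: mult_right_mono power_increasing\<close>)
  qed
  have \<epsilon>\<delta>: "(\<lambda>n. \<epsilon> n * \<delta> n) \<in> O(\<lambda>n. real n * \<epsilon> n ^ 2)"
    using landau_o.big_trans[OF landau_o.big.mult[OF landau_o.big_refl d, of \<epsilon>]] lift[of 0 1 2]
    by (simp add: power2_eq_square)
  have n\<delta>: "(\<lambda>n. real n * \<delta> n ^ 2) \<in> O(\<lambda>n. real n * \<epsilon> n ^ 2)"
    by (intro landau_o.big.mult landau_o.big_power d) auto
  have \<delta>R: "(\<lambda>n. \<delta> n * R n) \<in> O(\<lambda>n. real n ^ 2 * \<epsilon> n ^ 3)"
    using landau_o.big.mult[OF d R] by (simp add: power_mult_distrib power2_eq_square power3_eq_cube mult_ac)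
  have n\<epsilon>: "(\<lambda>n. real n * \<epsilon> n) \<in> O(\<lambda>_. 1)"
  proof (rule bigoI_tendsto[where c = 0])
    show "(\<lambda>n. real n * \<epsilon> n / 1) \<longlonglongrightarrow> 0"
      using powser_times_n_limit_0[of "1 / p"] p by (simp add: \<epsilon>_def)
  qed auto
  have \<delta>R': "(\<lambda>n. \<delta> n * R n) \<in> O(\<lambda>n. real n * \<epsilon> n ^ 2)"
    using landau_o.big_trans[OF \<delta>R] landau_o.big.mult[OF n\<epsilon> landau_o.big_refl, of "\<lambda>n. real n * \<epsilon> n ^ 2"]
    by (simp add: power2_eq_square power3_eq_cube mult_ac)
  \<comment> \<open>First iteration: every term after \<open>A \<epsilon>\<close> is an error.\<close>
  define e where "e n = \<delta> n - A * \<epsilon> n" for n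
  have "(\<lambda>n. - p * (\<epsilon> n * \<delta> n) + 1 / p * (real n * \<delta> n ^ 2) - \<delta> n * R n) \<in> O(\<lambda>n. real n * \<epsilon> n ^ 2)"
    using p by (intro sum_in_bigo) (use \<epsilon>\<delta> n\<delta> \<delta>R' in auto)
  then have e: "e \<in> O(\<lambda>n. real n * \<epsilon> n ^ 2)"
    by (rule landau_o.big.in_cong[THEN iffD2, rotated]) (use \<delta>_eq in \<open>eventually_elim, simp add: e_def\<close>)
  then show "(\<lambda>n. \<delta> n - A * \<epsilon> n) \<in> O(\<lambda>n. real n * \<epsilon> n ^ 2)"
    by (simp add: e_def[abs_def])
  \<comment> \<open>Second iteration: replacing \<open>\<delta>\<close> by \<open>A \<epsilon>\<close> in \<open>\<epsilon> \<delta>\<close> and in \<open>n \<delta>\<^sup>2\<close> leaves the errors \<open>\<epsilon> e\<close> and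
    \<open>n (\<delta>\<^sup>2 - A\<^sup>2 \<epsilon>\<^sup>2) = n e (\<delta> + A \<epsilon>)\<close>.\<close>
  have t1: "(\<lambda>n. \<epsilon> n * e n) \<in> O(\<lambda>n. real n ^ 2 * \<epsilon> n ^ 3)"
    using landau_o.big_trans[OF landau_o.big.mult[OF landau_o.big_refl e, of \<epsilon>]] lift[of 1 2 3]
    by (simp add: power2_eq_square power3_eq_cube mult_ac)
  have plus: "(\<lambda>n. \<delta> n + A * \<epsilon> n) \<in> O(\<epsilon>)"
    using d by (intro sum_in_bigo) auto
  have t2: "(\<lambda>n. real n * (e n * (\<delta> n + A * \<epsilon> n))) \<in> O(\<lambda>n. real n ^ 2 * \<epsilon> n ^ 3)"
    using landau_o.big.mult[OF landau_o.big_refl landau_o.big.mult[OF e plus], of real]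
    by (simp add: power2_eq_square power3_eq_cube mult_ac)
  have "(\<lambda>n. - p * (\<epsilon> n * e n) + 1 / p * (real n * (e n * (\<delta> n + A * \<epsilon> n))) - \<delta> n * R n)
      \<in> O(\<lambda>n. real n ^ 2 * \<epsilon> n ^ 3)"
    using p by (intro sum_in_bigo) (use t1 t2 \<delta>R in auto)
  then show "(\<lambda>n. \<delta> n - (A * \<epsilon> n - p * A * \<epsilon> n ^ 2 + A\<^sup>2 / p * real n * \<epsilon> n ^ 2))
      \<in> O(\<lambda>n. real n ^ 2 * \<epsilon> n ^ 3)"
  proof (rule landau_o.big.in_cong[THEN iffD2, rotated])
    show "\<forall>\<^sub>F n in sequentially. \<delta> n - (A * \<epsilon> n - p * A * \<epsilon> n ^ 2 + A\<^sup>2 / p * real n * \<epsilon> n ^ 2)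
        = - p * (\<epsilon> n * e n) + 1 / p * (real n * (e n * (\<delta> n + A * \<epsilon> n))) - \<delta> n * R n"
      using \<delta>_eq
    proof eventually_elim
      case (elim n)
      then show ?case
        using p by (simp add: e_def field_simps power2_eq_square)
    qed
  qed
qed

section \<open>The smallest eigenvalue\<close>

lemma exp_neg_mult_omega:
  assumes "\<alpha> < 0"
  shows "exp (- (real k * real n * omega \<alpha>)) = ((1 / (1 - 2 * \<alpha>)) ^ n) ^ k"
proof -
  have "exp (- (real k * real n * omega \<alpha>)) = exp (real (n * k) * (- omega \<alpha>))"
    by (simp add: mult_ac)
  also have "\<dots> = exp (- omega \<alpha>) ^ (n * k)"
    by (rule exp_of_nat_mult)
  also have "exp (- omega \<alpha>) = 1 / (1 - 2 * \<alpha>)"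
    using assms by (simp add: omega_def exp_minus field_simps)
  finally show ?thesis by (simp only: power_mult)
qed

text \<open>
  The purely algebraic part of the expansion, with \<open>N\<close> and \<open>x\<close> in the roles of \<open>n\<close> and \<open>\<epsilon> = p ^ (-n)\<close>.  It comes from
  \<open>1 / (p - \<delta>) = 1 / p + \<delta> / p\<^sup>2 + \<delta>\<^sup>2 / p\<^sup>3 + \<delta>\<^sup>3 / (p\<^sup>3 (p - \<delta>))\<close>, and the right-hand side is arranged as
  three quantities that are each \<open>O(N\<^sup>2 x\<^sup>3)\<close> when \<open>\<delta>\<close> is the secular root.
\<close>

lemma secular_lambda_expansion:
  fixes p \<delta> x N :: real
  defines "A \<equiv> p\<^sup>2 - 1"
  assumes p: "p > 0" and q: "p - \<delta> > 0"
  shows "2 - (p - \<delta>) - 1 / (p - \<delta>)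
      - (2 - p - 1 / p + A\<^sup>2 / p ^ 2 * x + A ^ 3 / p ^ 3 * N * x ^ 2 - A\<^sup>2 * (p\<^sup>2 + 1) / p ^ 3 * x ^ 2)
    = A / p\<^sup>2 * (\<delta> - (A * x - p * A * x ^ 2 + A\<^sup>2 / p * N * x ^ 2))
      - 1 / p ^ 3 * ((\<delta> - A * x) * (\<delta> + A * x)) - 1 / p ^ 3 * (1 / (p - \<delta>) * \<delta> ^ 3)"
proof -
  have inv: "1 / (p - \<delta>) = 1 / p + \<delta> / p ^ 2 + \<delta> ^ 2 / p ^ 3 + 1 / p ^ 3 * (1 / (p - \<delta>) * \<delta> ^ 3)"
    using p q by (simp add: field_simps power2_eq_square power3_eq_cube)
  have "2 - (p - \<delta>) - (1 / p + \<delta> / p ^ 2 + \<delta> ^ 2 / p ^ 3)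
      - (2 - p - 1 / p + A\<^sup>2 / p ^ 2 * x + A ^ 3 / p ^ 3 * N * x ^ 2 - A\<^sup>2 * (p\<^sup>2 + 1) / p ^ 3 * x ^ 2)
    = A / p\<^sup>2 * (\<delta> - (A * x - p * A * x ^ 2 + A\<^sup>2 / p * N * x ^ 2))
      - 1 / p ^ 3 * ((\<delta> - A * x) * (\<delta> + A * x))"
    using p unfolding A_def by (simp add: field_simps power2_eq_square power3_eq_cube)
  then show ?thesis using inv by linarith
qed

text \<open>
  An asymptotic bound by a positive function holds from any starting index, since the finitely
  many exceptional ratios can be added to the constant.
\<close>

lemma bigo_imp_bound_from:
  fixes f g :: "nat \<Rightarrow> real"
  assumes "f \<in> O(g)" and pos: "\<And>n. n \<ge> N \<Longrightarrow> g n > 0"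
  shows "\<exists>C>0. \<forall>n\<ge>N. \<bar>f n\<bar> \<le> C * g n"
proof -
  obtain c where c: "c > 0" "\<forall>\<^sub>F n in sequentially. norm (f n) \<le> c * norm (g n)"
    using assms(1) by (elim landau_o.bigE)
  then obtain n0 where n0: "\<And>n. n \<ge> n0 \<Longrightarrow> \<bar>f n\<bar> \<le> c * \<bar>g n\<bar>"
    by (auto simp: eventually_sequentially)
  define S where "S = (\<Sum>i<n0. \<bar>f i\<bar> / \<bar>g i\<bar>)"
  have S: "S \<ge> 0" by (simp add: S_def sum_nonneg)
  have "\<bar>f n\<bar> \<le> (c + S) * g n" if n: "n \<ge> N" for n
  proof (cases "n \<ge> n0")
    case True
    then have "\<bar>f n\<bar> \<le> c * g n" using n0 pos[OF n] by fastforce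
    also have "\<dots> \<le> (c + S) * g n" using S pos[OF n] by (intro mult_right_mono) auto
    finally show ?thesis .
  next
    case False
    then have "\<bar>f n\<bar> / \<bar>g n\<bar> \<le> S"
      unfolding S_def by (intro member_le_sum) auto
    then have "\<bar>f n\<bar> / g n \<le> c + S" using c pos[OF n] by simp
    then show ?thesis using pos[OF n] by (simp add: field_simps)
  qed
  then show ?thesis using c S by (intro exI[of _ "c + S"]) auto
qed

lemma lambda_L_1_asymptotics:
  fixes \<alpha> :: real
  defines "\<epsilon> \<equiv> \<lambda>n::nat. (1 / (1 - 2 * \<alpha>)) ^ n"
  assumes \<alpha>: "\<alpha> < 0"
  shows "(\<lambda>n. lambda_L \<alpha> n 1 - Omega_lim \<alpha>) \<in> O(\<epsilon>)"
    and "(\<lambda>n. lambda_L \<alpha> n 1 - (Omega_lim \<alpha> + beta1 \<alpha> * \<epsilon> n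
        + beta2 \<alpha> * real n * \<epsilon> n ^ 2 - beta3 \<alpha> * \<epsilon> n ^ 2)) \<in> O(\<lambda>n. real n ^ 2 * \<epsilon> n ^ 3)"
proof -
  define p where "p = 1 - 2 * \<alpha>"
  define A where "A = p\<^sup>2 - 1"
  have p: "p > 1" using \<alpha> by (simp add: p_def)
  have "A > 0" using p by (simp add: A_def one_less_power)
  have \<alpha>p: "\<alpha> = (1 - p) / 2" by (simp add: p_def)
  have \<epsilon>: "\<epsilon> = (\<lambda>n. (1 / p) ^ n)" by (simp add: \<epsilon>_def p_def)
  have \<Omega>: "Omega_lim \<alpha> = 2 - p - 1 / p"
    using p by (simp add: Omega_lim_def \<alpha>p field_simps power2_eq_square)
  have pA: "A = 4 * \<alpha> * (\<alpha> - 1)" and p2: "p\<^sup>2 + 1 = 2 * (2 * \<alpha>\<^sup>2 - 2 * \<alpha> + 1)"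
    by (simp_all add: A_def p_def algebra_simps power2_eq_square)
  have \<beta>: "beta1 \<alpha> = A\<^sup>2 / p ^ 2" "beta2 \<alpha> = A ^ 3 / p ^ 3" "beta3 \<alpha> = A\<^sup>2 * (p\<^sup>2 + 1) / p ^ 3"
    unfolding beta1_def beta2_def beta3_def p2 pA p_def[symmetric]
    by (simp_all add: power_mult_distrib power2_commute[of 1])
  define P where "P n t \<longleftrightarrow> 0 \<le> t \<and> t \<le> 2 * A * \<epsilon> n \<and> p - t > 1 \<and> t * (p - t) ^ n = p * (p - t) - 1"
    for n t
  define \<delta> where "\<delta> n = (SOME t. P n t)" for n
  have root: "\<forall>\<^sub>F n in sequentially. P n (\<delta> n)"
    using eventually_secular_root[OF p] unfolding A_def[symmetric]
    by eventually_elim (auto simp: \<delta>_def P_def \<epsilon> intro: someI2_ex)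
  have lam: "\<forall>\<^sub>F n in sequentially. lambda_L \<alpha> n 1 = 2 - (p - \<delta> n) - 1 / (p - \<delta> n)"
    using root eventually_ge_at_top[of 3]
  proof eventually_elim
    case (elim n)
    then have "(p - \<delta> n) ^ n * ((p - \<delta> n) - p) = 1 - p * (p - \<delta> n)"
      by (simp add: P_def algebra_simps)
    then show ?case
      using elim by (intro lambda_L_1_eq[of n "p - \<delta> n" \<alpha>, folded p_def]) (auto simp: P_def)
  qed
  note expansion = secular_root_expansion[OF p, of \<delta>, folded A_def \<epsilon>, OF root[unfolded P_def]]
  have bounded: "(\<lambda>n. 1 / (p - \<delta> n)) \<in> O(\<lambda>_. 1)"
    by (rule bigoI[of _ 1]) (use root in \<open>eventually_elim, auto simp: P_def\<close>)

  \<comment> \<open>The function \<open>q \<mapsto> 2 - q - 1 / q\<close> is Lipschitz for \<open>q > 1\<close>, so \<open>\<delta> = O(\<epsilon>)\<close> carries over.\<close>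
  have "(\<lambda>n. \<delta> n - 1 / p * (1 / (p - \<delta> n) * \<delta> n)) \<in> O(\<epsilon>)"
    using p landau_o.big.mult[OF bounded expansion(1)]
    by (intro sum_in_bigo expansion(1) landau_o.big.cmult_in_iff[THEN iffD2]) auto
  then show "(\<lambda>n. lambda_L \<alpha> n 1 - Omega_lim \<alpha>) \<in> O(\<epsilon>)"
  proof (rule landau_o.big.in_cong[THEN iffD2, rotated])
    show "\<forall>\<^sub>F n in sequentially. lambda_L \<alpha> n 1 - Omega_lim \<alpha> = \<delta> n - 1 / p * (1 / (p - \<delta> n) * \<delta> n)"
      using lam root
    proof eventually_elim
      case (elim n)
      have "1 / (p - \<delta> n) = 1 / p + 1 / p * (1 / (p - \<delta> n) * \<delta> n)"
        using elim(2) p by (simp add: P_def field_simps)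
      then show ?case unfolding elim(1) \<Omega> by linarith
    qed
  qed

  have drop: "(\<lambda>n. real n ^ a * \<epsilon> n ^ 3) \<in> O(\<lambda>n. real n ^ 2 * \<epsilon> n ^ 3)" if "a \<le> 2" for a :: nat
  proof (rule bigoI[of _ 1])
    show "\<forall>\<^sub>F n in sequentially. norm (real n ^ a * \<epsilon> n ^ 3) \<le> 1 * norm (real n ^ 2 * \<epsilon> n ^ 3)"
      using eventually_ge_at_top[of 1]
      by eventually_elim (use p that in \<open>auto simp: \<epsilon> abs_mult intro!: mult_right_mono power_increasing\<close>)
  qed
  have "(\<lambda>n. \<delta> n + A * \<epsilon> n) \<in> O(\<epsilon>)"
    using expansion(1) by (intro sum_in_bigo) auto
  from landau_o.big_trans[OF landau_o.big.mult[OF expansion(2) this]] drop[of 1]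
  have 2: "(\<lambda>n. (\<delta> n - A * \<epsilon> n) * (\<delta> n + A * \<epsilon> n)) \<in> O(\<lambda>n. real n ^ 2 * \<epsilon> n ^ 3)"
    by (simp add: power2_eq_square power3_eq_cube mult_ac)
  have 3: "(\<lambda>n. 1 / (p - \<delta> n) * \<delta> n ^ 3) \<in> O(\<lambda>n. real n ^ 2 * \<epsilon> n ^ 3)"
    using landau_o.big_trans[OF landau_o.big.mult[OF bounded landau_o.big_power[OF expansion(1), of 3]]] drop[of 0]
    by simp
  have "(\<lambda>n. A / p\<^sup>2 * (\<delta> n - (A * \<epsilon> n - p * A * \<epsilon> n ^ 2 + A\<^sup>2 / p * real n * \<epsilon> n ^ 2))
      - 1 / p ^ 3 * ((\<delta> n - A * \<epsilon> n) * (\<delta> n + A * \<epsilon> n)) - 1 / p ^ 3 * (1 / (p - \<delta> n) * \<delta> n ^ 3))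
      \<in> O(\<lambda>n. real n ^ 2 * \<epsilon> n ^ 3)"
    using p \<open>A > 0\<close>
    by (intro sum_in_bigo landau_o.big.cmult_in_iff[THEN iffD2] expansion(3) 2 3) auto
  then show "(\<lambda>n. lambda_L \<alpha> n 1 - (Omega_lim \<alpha> + beta1 \<alpha> * \<epsilon> n
        + beta2 \<alpha> * real n * \<epsilon> n ^ 2 - beta3 \<alpha> * \<epsilon> n ^ 2)) \<in> O(\<lambda>n. real n ^ 2 * \<epsilon> n ^ 3)"
  proof (rule landau_o.big.in_cong[THEN iffD2, rotated])
    show "\<forall>\<^sub>F n in sequentially. lambda_L \<alpha> n 1 - (Omega_lim \<alpha> + beta1 \<alpha> * \<epsilon> n
        + beta2 \<alpha> * real n * \<epsilon> n ^ 2 - beta3 \<alpha> * \<epsilon> n ^ 2) =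
      A / p\<^sup>2 * (\<delta> n - (A * \<epsilon> n - p * A * \<epsilon> n ^ 2 + A\<^sup>2 / p * real n * \<epsilon> n ^ 2))
      - 1 / p ^ 3 * ((\<delta> n - A * \<epsilon> n) * (\<delta> n + A * \<epsilon> n)) - 1 / p ^ 3 * (1 / (p - \<delta> n) * \<delta> n ^ 3)"
      using lam root
    proof eventually_elim
      case (elim n)
      then have "p > 0" "p - \<delta> n > 0" using p by (auto simp: P_def)
      from secular_lambda_expansion[OF this, folded A_def] show ?case
        unfolding elim(1) \<Omega> \<beta> .
    qed
  qed
qed

theorem theorem2p4:
  fixes \<alpha> :: real
  assumes "\<alpha> < 0"
  shows "(\<lambda>n. lambda_L \<alpha> n 1) \<longlonglongrightarrow> Omega_lim \<alpha>
    \<and> (\<exists>r>0. \<exists>C>0. \<forall>n::nat. int n \<ge> N_min \<alpha> \<longrightarrow>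
          \<bar>lambda_L \<alpha> n 1 - Omega_lim \<alpha>\<bar> \<le> C * exp (- (r * real n)))
    \<and> (\<exists>C2>0. \<forall>n::nat. int n \<ge> N_min \<alpha> \<longrightarrow>
          \<bar>lambda_L \<alpha> n 1
            - (Omega_lim \<alpha> + beta1 \<alpha> * exp (- (real n * omega \<alpha>))
                + beta2 \<alpha> * real n * exp (- (2 * real n * omega \<alpha>))
                - beta3 \<alpha> * exp (- (2 * real n * omega \<alpha>)))\<bar>
          \<le> C2 * (real n)^2 * exp (- (3 * real n * omega \<alpha>)))"
proof (intro conjI)
  define \<epsilon> where "\<epsilon> = (\<lambda>n::nat. (1 / (1 - 2 * \<alpha>)) ^ n)"
  note asymp = lambda_L_1_asymptotics[OF assms, folded \<epsilon>_def]
  have N: "n \<ge> 3" if "int n \<ge> N_min \<alpha>" for n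
    using that by (simp add: N_min_def)
  have pos: "\<epsilon> n > 0" for n using assms by (simp add: \<epsilon>_def)
  have exp1: "exp (- (real n * omega \<alpha>)) = \<epsilon> n" and exp2: "exp (- (2 * real n * omega \<alpha>)) = \<epsilon> n ^ 2"
    and exp3: "exp (- (3 * real n * omega \<alpha>)) = \<epsilon> n ^ 3" for n
    using exp_neg_mult_omega[OF assms, of 1 n] exp_neg_mult_omega[OF assms, of 2 n]
      exp_neg_mult_omega[OF assms, of 3 n] by (simp_all add: \<epsilon>_def)
  obtain C where C: "C > 0" "\<And>n. n \<ge> 3 \<Longrightarrow> \<bar>lambda_L \<alpha> n 1 - Omega_lim \<alpha>\<bar> \<le> C * \<epsilon> n"
    using bigo_imp_bound_from[OF asymp(1), of 3] pos by blast
  have "\<epsilon> \<longlonglongrightarrow> 0"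
    unfolding \<epsilon>_def using assms by (intro LIMSEQ_power_zero) auto
  then have "(\<lambda>n. lambda_L \<alpha> n 1 - Omega_lim \<alpha>) \<longlonglongrightarrow> 0"
    by (rule tendsto_0_le[where K = C])
      (use C(2) pos in \<open>auto simp: eventually_sequentially mult.commute abs_of_pos intro!: exI[of _ 3]\<close>)
  then show "(\<lambda>n. lambda_L \<alpha> n 1) \<longlonglongrightarrow> Omega_lim \<alpha>"
    by (simp add: LIM_zero_iff)
  have "omega \<alpha> > 0" using assms by (simp add: omega_def)
  then show "\<exists>r>0. \<exists>C>0. \<forall>n::nat. int n \<ge> N_min \<alpha> \<longrightarrow>
      \<bar>lambda_L \<alpha> n 1 - Omega_lim \<alpha>\<bar> \<le> C * exp (- (r * real n))"
    using C N exp1 by (intro exI[of _ "omega \<alpha>"] conjI exI[of _ C]) (auto simp: mult.commute)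
  show "\<exists>C2>0. \<forall>n::nat. int n \<ge> N_min \<alpha> \<longrightarrow>
          \<bar>lambda_L \<alpha> n 1
            - (Omega_lim \<alpha> + beta1 \<alpha> * exp (- (real n * omega \<alpha>))
                + beta2 \<alpha> * real n * exp (- (2 * real n * omega \<alpha>))
                - beta3 \<alpha> * exp (- (2 * real n * omega \<alpha>)))\<bar>
          \<le> C2 * (real n)^2 * exp (- (3 * real n * omega \<alpha>))"
    using bigo_imp_bound_from[OF asymp(2), of 3] pos N unfolding exp1 exp2 exp3
    by (simp add: mult.assoc) blast
qed

end
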